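(* Let $A_1,A_2\in\mathbf{C}^{n\times n}$, $B_1,B_2\in\mathbf{C}^{n\times m}$ be such that $(\{A_1,A_2\},\{B_1,B_2\})$ is controllable, and let $\{F_1,F_2\}\in\{\mathbf{C}^{p\times p},\mathbf{C}^{p\times p}\}$ with $p$ any positive integer. Let $\{N_1(s),N_2(s)\}$ (of size $n\times m$) and $\{D_1(s),D_2(s)\}$ (of size $m\times m$) be two polynomial bimatrices such that $$\{sI_n-A_1,-A_2\}\{N_1(s),N_2(s)\}=\{B_1,B_2\}\{D_1(s),D_2(s)\},$$ and such that $\{N_1(s),N_2(s)\}$ and $\{D_1(s),D_2(s)\}$ are right-coprime. Write $$\begin{bmatrix} N_j(s) \\ D_j(s) \end{bmatrix}=\sum_{i=0}^{\omega}\begin{bmatrix} N_{ji} \\ D_{ji} \end{bmatrix}s^i,\quad j=1,2,\ \omega\in\mathbf{Z}^+ .$$ Then complete solutions to the generalized Sylvester bimatrix equation $$\{A_1,A_2\}\{X_1,X_2\}+\{B_1,B_2\}\{Y_1,Y_2\}=\{X_1,X_2\}\{F_1,F_2\}$$ in the unknowns $\{X_1,X_2\}\in\{\mathbf{C}^{n\times p},\mathbf{C}^{n\times p}\}$, $\{Y_1,Y_2\}\in\{\mathbf{C}^{m\times p},\mathbf{C}^{m\times p}\}$ are given by $$\{X_1,X_2\}=\sum_{i=0}^{\omega}\{N_{1i},N_{2i}\}\{Z_1,Z_2\}\{F_1,F_2\}^i,\qquad \{Y_1,Y_2\}=\sum_{i=0}^{\omega}\{D_{1i},D_{2i}\}\{Z_1,Z_2\}\{F_1,F_2\}^i,$$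 where $\{Z_1,Z_2\}\in\{\mathbf{C}^{m\times p},\mathbf{C}^{m\times p}\}$ is an arbitrary bimatrix; that is, the solutions are exactly the pairs of this form.
   Context: $A^{\#}$ denotes the entrywise complex conjugate of $A$; $\mathbf{Z}^+=\{0,1,2,\dots\}$. A bimatrix $\{A_1,A_2\}\in\{\mathbf{C}^{n\times m},\mathbf{C}^{n\times m}\}$ is a pair of matrices of the same size, identified with the real-linear map $x\mapsto A_1x+A_2^{\#}x^{\#}$. Addition is componentwise, and the product corresponds to composition: $\{A_1,A_2\}\{X_1,X_2\}=\{A_1X_1+A_2^{\#}X_2,\;A_1^{\#}X_2+A_2X_1\}$; $\{F_1,F_2\}^0=\{I_p,0_{p\times p}\}$. The same formulas are used for polynomial bimatrices $\{P_1(s),P_2(s)\}$ (pairs of matrices with entries in $\mathbf{C}[s]$), where $s$ is treated as a real parameter when conjugating, i.e. $s^{\#}=s$ and $P^{\#}(s)$ is obtained by conjugating the coefficients. The complex lifting is $\{P_1,P_2\}_\diamond=\begin{bmatrix} P_1 & P_2^{\#} \\ P_2 & P_1^{\#} \end{bmatrix}$, the rank of a bimatrix is the rank of its complex lifting, and eigenvalues of a square bimatrix are those of its complex lifting. Polynomial bimatrices $\{N_1(s),N_2(s)\}$ and $\{D_1(s),D_2(s)\}$ are right-coprime if $$\mathrm{rank}\left\{\begin{bmatrix} N_1(s) \\ D_1(s) \end{bmatrix},\begin{bmatrix} N_2(s) \\ D_2(s) \end{bmatrix}\right\}=2m,\quad\forall s\in\mathbf{C},$$ i.e. for every $s\in\mathbf{C}$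 the matrix $\begin{bmatrix} N_1(s) & N_2^{\#}(s) \\ D_1(s) & D_2^{\#}(s) \\ N_2(s) & N_1^{\#}(s) \\ D_2(s) & D_1^{\#}(s) \end{bmatrix}$ has rank $2m$. The pair $(\{A_1,A_2\},\{B_1,B_2\})$ is controllable if the system $x^+=\{A_1,A_2\}x+\{B_1,B_2\}u$ is controllable, equivalently the matrix pair $(\{A_1,A_2\}_\diamond,\{B_1,B_2\}_\diamond)$ is controllable, i.e. $\mathrm{rank}\,[\,sI_{2n}-\{A_1,A_2\}_\diamond,\ \{B_1,B_2\}_\diamond\,]=2n$ for all $s\in\mathbf{C}$. *)

theory Defs
  imports "HOL-Analysis.Analysis" "HOL-Computational_Algebra.Polynomial"
begin

class conj_ring = comm_ring_1 +
  fixes cconj :: "'a \<Rightarrow> 'a"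
  assumes cconj_add: "cconj (x + y) = cconj x + cconj y"
    and cconj_mult: "cconj (x * y) = cconj x * cconj y"
    and cconj_cconj: "cconj (cconj x) = x"
begin

lemma cconj_zero: "cconj 0 = 0"
  using cconj_add[of 0 0] by simp

lemma cconj_sum: "cconj (sum f S) = (\<Sum>i\<in>S. cconj (f i))"
  by (induction S rule: infinite_finite_induct) (simp_all add: cconj_zero cconj_add)

end

instantiation complex :: conj_ring
begin

definition cconj_complex :: "complex \<Rightarrow> complex" where
  "cconj_complex = cnj"

instance
  by standard (simp_all add: cconj_complex_def)

end

text \<open>The indeterminate is treated as a real parameter, so only the coefficients are conjugated.\<close>

instantiation poly :: (conj_ring) conj_ring
begin

definition cconj_poly :: "'a poly \<Rightarrow> 'a poly" where
  "cconj_poly = map_poly cconj"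

instance
  by standard
    (simp_all add: cconj_poly_def poly_eq_iff coeff_map_poly cconj_zero cconj_add
      coeff_mult cconj_sum cconj_mult cconj_cconj)

end

definition mconj :: "'a::conj_ring^'m^'n \<Rightarrow> 'a^'m^'n" (\<open>(_\<^sup>#)\<close> [1000] 999) where
  "A\<^sup># = (\<chi> i j. cconj (A $ i $ j))"

definition hcat :: "'a^'m^'n \<Rightarrow> 'a^'k^'n \<Rightarrow> 'a^('m + 'k)^'n" where
  "hcat A B = (\<chi> i j. case j of Inl k \<Rightarrow> A $ i $ k | Inr k \<Rightarrow> B $ i $ k)"

definition vcat :: "'a^'m^'n \<Rightarrow> 'a^'m^'k \<Rightarrow> 'a^'m^('n + 'k)" where
  "vcat A B = (\<chi> i. case i of Inl k \<Rightarrow> A $ k | Inr k \<Rightarrow> B $ k)"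

text \<open>A bimatrix with rows indexed by \<open>'n\<close> and columns indexed by \<open>'m\<close>. Addition, negation and
  finite sums are the componentwise ones of the product type.\<close>

type_synonym ('a, 'n, 'm) bimatrix = "('a^'m^'n) \<times> ('a^'m^'n)"

text \<open>The product is composition of the real-linear maps \<open>x \<mapsto> A\<^sub>1 x + A\<^sub>2\<^sup># x\<^sup>#\<close>.\<close>

fun bmult ::
  "('a::conj_ring, 'n::finite, 'k::finite) bimatrix \<Rightarrow> ('a, 'k, 'm::finite) bimatrix \<Rightarrow>
    ('a, 'n, 'm) bimatrix"
  (infixl \<open>\<odot>\<close> 70) where
  "(A1, A2) \<odot> (X1, X2) = (A1 ** X1 + A2\<^sup># ** X2, A1\<^sup># ** X2 + A2 ** X1)"

primrec bpow ::
  "('a::conj_ring, 'p::finite, 'p) bimatrix \<Rightarrow> nat \<Rightarrow> ('a, 'p, 'p) bimatrix" where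
  "bpow F 0 = (mat 1, 0)"
| "bpow F (Suc k) = bpow F k \<odot> F"

fun lifting :: "('a::conj_ring, 'n::finite, 'm::finite) bimatrix \<Rightarrow> 'a^('m + 'm)^('n + 'n)" where
  "lifting (P1, P2) = vcat (hcat P1 (P2\<^sup>#)) (hcat P2 (P1\<^sup>#))"

fun bvcat ::
  "('a, 'n::finite, 'm::finite) bimatrix \<Rightarrow> ('a, 'k::finite, 'm) bimatrix \<Rightarrow>
    ('a, 'n + 'k, 'm) bimatrix" where
  "bvcat (N1, N2) (D1, D2) = (vcat N1 D1, vcat N2 D2)"

definition pconst :: "'a::zero^'m^'n \<Rightarrow> 'a poly^'m^'n" where
  "pconst A = (\<chi> i j. [:A $ i $ j:])"

definition pmonom :: "'a::zero^'m^'n \<Rightarrow> nat \<Rightarrow> 'a poly^'m^'n" where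
  "pmonom A k = (\<chi> i j. monom (A $ i $ j) k)"

definition peval :: "'a::comm_semiring_0 poly^'m^'n \<Rightarrow> 'a \<Rightarrow> 'a^'m^'n" where
  "peval P s = (\<chi> i j. poly (P $ i $ j) s)"

text \<open>The lifting is formed on the level of polynomials and evaluated afterwards: for non-real
  \<open>s\<close>, evaluation does not commute with conjugation.\<close>

definition right_coprime ::
  "(complex poly, 'n::finite, 'm::finite) bimatrix \<Rightarrow> (complex poly, 'k::finite, 'm) bimatrix \<Rightarrow>
    bool" where
  "right_coprime N (D :: (complex poly, 'k, 'm) bimatrix) \<longleftrightarrow>
     (\<forall>s. rank (peval (lifting (bvcat N D)) s) = 2 * CARD('m))"

text \<open>The Popov-Belevitch-Hautus rank condition for the complex lifting.\<close>

definition controllable ::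
  "(complex, 'n::finite, 'n) bimatrix \<Rightarrow> (complex, 'n, 'm::finite) bimatrix \<Rightarrow> bool" where
  "controllable (A :: (complex, 'n, 'n) bimatrix) B \<longleftrightarrow>
     (\<forall>s. rank (hcat (mat s - lifting A) (lifting B)) = 2 * CARD('n))"

end

theory Submission
  imports Defs "HOL-Computational_Algebra.Fundamental_Theorem_Algebra"
begin

text \<open>Lifting turns the bimatrix equation into a complex Sylvester equation \<open>A X + B Y = X F\<close>. Put
  \<open>T (X, Y) = A X + B Y - X F\<close> and \<open>G Z = (\<Sum>i. N\<^sub>i Z F\<^sup>i, \<Sum>i. D\<^sub>i Z F\<^sup>i)\<close>. The range of \<open>T\<close> and the
  kernel of \<open>G\<close> are stable under right multiplication by \<open>F\<close>, and some product of factors \<open>F - a\<close>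
  is zero. Controllability writes every \<open>R\<close> as an element of the range of \<open>T\<close> plus \<open>U (F - a)\<close>, so
  iterating over the factors shows that \<open>T\<close> is surjective. Coprimeness excludes \<open>Z (F - a) = 0\<close> for
  nonzero \<open>Z\<close> in the kernel of \<open>G\<close>, so \<open>G\<close> is injective. Since \<open>T \<circ> G = 0\<close>, comparing dimensions gives
  that the range of \<open>G\<close> is the kernel of \<open>T\<close>. Finally, liftings are the fixed points of conjugation
  combined with the exchange of the two blocks; this symmetry commutes with \<open>G\<close>, so the unique \<open>Z\<close>
  that belongs to a lifted solution is itself a lifting.\<close>

subsection \<open>Matrix arithmetic\<close>

lemma matrix_mult_sum_left: "sum f S ** M = (\<Sum>i\<in>S. f i ** M)"
  for M :: "'a::ring_1^'n::finite^'m::finite"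
  by (induction S rule: infinite_finite_induct)
    (simp_all add: vec_eq_iff matrix_matrix_mult_def distrib_right sum.distrib)

lemma matrix_mult_sum_right: "M ** sum f S = (\<Sum>i\<in>S. M ** f i)"
  for M :: "'a::ring_1^'n::finite^'m::finite"
  by (induction S rule: infinite_finite_induct)
    (simp_all add: vec_eq_iff matrix_matrix_mult_def distrib_left sum.distrib)

lemma matrix_mult_add_left: "(A + B) ** M = A ** M + B ** M"
  for M :: "'a::ring_1^'n::finite^'m::finite"
  by (simp add: vec_eq_iff matrix_matrix_mult_def distrib_right sum.distrib)

lemma matrix_mult_minus_left: "(- A) ** M = - (A ** M)"
  for M :: "'a::ring_1^'n::finite^'m::finite"
  by (simp add: vec_eq_iff matrix_matrix_mult_def sum_negf)

lemma matrix_mult_minus_right: "A ** (- M) = - (A ** M)"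
  for M :: "'a::ring_1^'n::finite^'m::finite"
  by (simp add: vec_eq_iff matrix_matrix_mult_def sum_negf)

lemma matrix_mult_diff_left: "(A - B) ** M = A ** M - B ** M"
  for M :: "'a::ring_1^'n::finite^'m::finite"
  by (simp add: vec_eq_iff matrix_matrix_mult_def left_diff_distrib sum_subtractf)

lemma matrix_mult_diff_right: "A ** (M - N) = A ** M - A ** N"
  for M :: "'a::ring_1^'n::finite^'m::finite"
  by (simp add: vec_eq_iff matrix_matrix_mult_def right_diff_distrib sum_subtractf)

lemmas matrix_distribs =
  matrix_mult_add_left matrix_add_ldistrib matrix_mult_diff_left matrix_mult_diff_right
  matrix_mult_minus_left matrix_mult_minus_right

lemma mat_mult_component: "(mat c ** M) $ i $ j = c * M $ i $ j"
  for M :: "'a::comm_ring_1^'n::finite^'m::finite"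
  by (simp add: matrix_matrix_mult_def mat_def if_distrib[of "\<lambda>x. x * _"] cong: if_cong)

lemma mult_mat_component: "(M ** mat c) $ i $ j = c * M $ i $ j"
  for M :: "'a::comm_ring_1^'n::finite^'m::finite"
  by (simp add: matrix_matrix_mult_def mat_def if_distrib mult.commute cong: if_cong)

lemma mat_mult_commute: "M ** mat c = mat c ** M"
  for M :: "'a::comm_ring_1^'n::finite^'m::finite"
  by (simp add: vec_eq_iff mat_mult_component mult_mat_component)

lemma mat_mult_left_commute: "M ** (mat c ** N) = mat c ** (M ** N)"
  for M :: "'a::comm_ring_1^'n::finite^'m::finite"
  by (metis mat_mult_commute matrix_mul_assoc)

lemma mat_mult_mat: "mat c ** mat d = mat (c * d :: 'a::comm_ring_1)"
  by (simp add: vec_eq_iff mat_mult_component) (simp add: mat_def)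

lemma matrix_scaleR_left: "(r *\<^sub>R A) ** B = r *\<^sub>R (A ** B)"
  for A :: "complex^'n::finite^'m::finite"
  by (simp add: vec_eq_iff matrix_matrix_mult_def scaleR_sum_right)

lemma matrix_scaleR_right: "A ** (r *\<^sub>R B) = r *\<^sub>R (A ** B)"
  for A :: "complex^'n::finite^'m::finite"
  by (simp add: vec_eq_iff matrix_matrix_mult_def scaleR_sum_right)

lemma matrix_mult_eq_0_if_injective:
  fixes M :: "'a::comm_ring_1^'n::finite^'m::finite" and Z :: "'a^'q::finite^'n"
  assumes "\<And>v. M *v v = 0 \<Longrightarrow> N *v v = 0 \<Longrightarrow> v = 0" "M ** Z = 0" "N ** Z = 0"
  shows "Z = 0"
proof -
  have "Z *v w = 0" for w
    using assms by (metis matrix_vector_mul_assoc matrix_vector_mult_0)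
  then show ?thesis by (simp add: matrix_eq)
qed

subsection \<open>Full rank\<close>

text \<open>The rows span the whole space, which gives a left inverse. Right-coprimeness is used in
  this form.\<close>

lemma injective_if_full_column_rank:
  fixes A :: "'a::field^'n::finite^'m::finite"
  assumes "rank A = CARD('n)" "A *v v = 0"
  shows "v = 0"
proof -
  have "vec.span (rows A) = UNIV"
    using assms(1) by (metis row_rank_def_gen vec.dim_eq_full vec_dim_card vec.dim_UNIV vec.dimension_def)
  then obtain B where "B ** A = mat 1"
    using matrix_left_invertible_span_rows_gen by blast
  then show ?thesis
    by (metis assms(2) matrix_vector_mul_assoc matrix_vector_mul_lid matrix_vector_mult_0_right)
qed

text \<open>The rank is the dimension of the set of rows, where equal rows collapse. Squeezing the
  cardinality of that set between the rank and the number of rows shows that the rows are distinct;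
  only then does independence of the set give independence of the indexed family.\<close>

lemma right_invertible_if_full_row_rank:
  fixes A :: "'a::field^'n::finite^'m::finite"
  assumes "rank A = CARD('m)"
  obtains B where "A ** B = mat 1"
proof -
  let ?row = "\<lambda>i. row i A"
  have rows: "rows A = range ?row" by (auto simp: rows_def)
  have "vec.dim (rows A) \<le> card (rows A)"
    by (intro vec.dim_le_card) (auto simp: rows intro: vec.span_base)
  moreover have "card (rows A) \<le> CARD('m)"
    unfolding rows by (rule card_image_le) simp
  ultimately have card: "card (rows A) = CARD('m)"
    using assms by (simp add: row_rank_def_gen)
  then have inj: "inj ?row"
    unfolding rows by (intro eq_card_imp_inj_on) auto
  have ind: "vec.independent (rows A)"
    using card assms
    by (intro vec.card_le_dim_spanning[of _ "rows A"])
      (auto simp: rows row_rank_def_gen intro: vec.span_base)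
  have "c i = 0" if "(\<Sum>i\<in>UNIV. c i *s row i A) = 0" for c i
  proof -
    have "(\<Sum>v\<in>rows A. c (inv ?row v) *s v) = 0"
      unfolding rows using that by (simp add: sum.reindex[OF inj] inv_f_f[OF inj])
    then have "c (inv ?row (row i A)) = 0"
      using vec.independentD[OF ind, of "rows A" "\<lambda>v. c (inv ?row v)" "row i A"]
      by (auto simp: rows)
    then show ?thesis by (simp only: inv_f_f[OF inj])
  qed
  then have "\<exists>B. A ** B = mat 1"
    by (subst matrix_right_invertible_independent_rows) simp
  then show ?thesis using that by (elim exE)
qed

subsection \<open>A product of linear factors that annihilates a complex matrix\<close>

primrec mpow :: "'a::comm_ring_1^'n::finite^'n \<Rightarrow> nat \<Rightarrow> 'a^'n^'n" where
  "mpow F 0 = mat 1"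
| "mpow F (Suc k) = mpow F k ** F"

lemma mpow_commute: "G ** F = F ** G \<Longrightarrow> mpow F k ** G = G ** mpow F k"
  by (induction k) (simp_all, metis matrix_mul_assoc)

text \<open>The accumulator \<open>Z\<close> may be rectangular, so factors can be split off at
  either end: the first one in the injectivity argument, the last one in the surjectivity
  argument.\<close>

definition mfactors :: "'a::comm_ring_1^'n::finite^'n \<Rightarrow> 'a list \<Rightarrow> 'a^'n^'m::finite \<Rightarrow> 'a^'n^'m" where
  "mfactors F as Z = foldl (\<lambda>M a. M ** (F - mat a)) Z as"

lemma mfactors_Nil [simp]: "mfactors F [] Z = Z"
  and mfactors_Cons: "mfactors F (a # as) Z = mfactors F as (Z ** (F - mat a))"
  and mfactors_snoc: "mfactors F (as @ [a]) Z = mfactors F as Z ** (F - mat a)"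
  by (simp_all add: mfactors_def)

lemma mfactors_eq_mult: "mfactors F as Z = Z ** mfactors F as (mat 1)"
  by (induction as rule: rev_induct) (simp_all add: mfactors_snoc matrix_mul_assoc)

text \<open>Horner evaluation of the polynomial \<open>p\<close> at the matrix
  \<open>F\<close>.\<close>

definition mpoly :: "'a::comm_ring_1^'n::finite^'n \<Rightarrow> 'a poly \<Rightarrow> 'a^'n^'n" where
  "mpoly F p = fold_coeffs (\<lambda>a M. mat a + M ** F) p 0"

lemma mpoly_0 [simp]: "mpoly F 0 = 0"
  by (simp add: mpoly_def)

lemma mpoly_pCons [simp]: "mpoly F (pCons a p) = mat a + mpoly F p ** F"
  by (cases "a = 0 \<and> p = 0") (auto simp: mpoly_def)

lemma mat_add: "mat (a + b) = mat a + (mat b :: 'a::comm_ring_1^'n::finite^'n)"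
  by (simp add: vec_eq_iff mat_def)

lemma mpoly_add: "mpoly F (p + q) = mpoly F p + mpoly F q"
  by (induction p q rule: poly_induct2) (simp_all add: matrix_distribs mat_add algebra_simps)

lemma mpoly_smult: "mpoly F (smult c p) = mat c ** mpoly F p"
  by (induction p) (simp_all add: matrix_distribs mat_mult_mat matrix_mul_assoc)

lemma mpoly_linear_factor: "mpoly F ([:-a, 1:] * p) = mpoly F p ** (F - mat a)"
proof -
  have "[:-a, 1:] * p = smult (-a) p + pCons 0 p" by simp
  moreover have "mat (- a) = - (mat a :: 'a^'b^'b)"
    by (simp add: vec_eq_iff mat_def)
  ultimately show ?thesis
    by (simp only: mpoly_add mpoly_smult mpoly_pCons)
      (simp add: matrix_distribs mat_mult_commute)
qed

lemma mpoly_monom: "mpoly F (monom c k) = mat c ** mpow F k"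
  by (induction k) (simp_all add: monom_0 monom_Suc matrix_mul_assoc)

lemma mpoly_sum: "mpoly F (sum f S) = (\<Sum>i\<in>S. mpoly F (f i))"
  by (induction S rule: infinite_finite_induct) (simp_all add: mpoly_add)

text \<open>By the fundamental theorem of algebra a root can be split off until only a nonzero
  constant remains.\<close>

lemma mpoly_eq_mfactors:
  fixes F :: "complex^'n::finite^'n"
  assumes "p \<noteq> 0"
  shows "\<exists>c as. c \<noteq> 0 \<and> mpoly F p = mat c ** mfactors F as (mat 1)"
  using assms
proof (induction "degree p" arbitrary: p)
  case 0
  then obtain c where "p = [:c:]" using degree_eq_zeroE by metis
  with 0 show ?case
    by (intro exI[of _ c] exI[of _ "[]"]) auto
next
  case (Suc d)
  then have "\<not> constant (poly p)" by (simp add: constant_degree)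
  then obtain a where "poly p a = 0" using fundamental_theorem_of_algebra by blast
  then obtain r where r: "p = [:-a, 1:] * r" by (auto simp: poly_eq_0_iff_dvd)
  with Suc.prems have "r \<noteq> 0" by auto
  then have "degree p = Suc (degree r)"
    unfolding r by (subst degree_mult_eq) auto
  with Suc.hyps(2) have "d = degree r" by simp
  from Suc.hyps(1)[OF this \<open>r \<noteq> 0\<close>] obtain c as where
    "c \<noteq> 0" "mpoly F r = mat c ** mfactors F as (mat 1)" by blast
  then show ?case
    unfolding r mpoly_linear_factor
    by (intro exI[of _ c] exI[of _ "as @ [a]"]) (simp add: mfactors_snoc matrix_mul_assoc)
qed

text \<open>One term more than the dimension suffices. Dependence of a set does not see repetitions,
  so equal terms \<open>g i = g j\<close> are treated separately by the relation
  \<open>g i - g j = 0\<close>.\<close>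

lemma sequence_linearly_dependent:
  fixes g :: "nat \<Rightarrow> 'a::euclidean_space"
  obtains c n where "\<exists>i\<le>n. c i \<noteq> (0::real)" "(\<Sum>i\<le>n. c i *\<^sub>R g i) = 0"
proof (cases "inj_on g {..DIM('a)}")
  case True
  let ?S = "{..DIM('a)}"
  have "card (g ` ?S) = Suc (DIM('a))" using True by (simp add: card_image)
  then have "dependent (g ` ?S)" using independent_bound[of "g ` ?S"] by auto
  then obtain u v where "v \<in> g ` ?S" "u v \<noteq> 0" "(\<Sum>v\<in>g ` ?S. u v *\<^sub>R v) = 0"
    by (auto simp: dependent_finite)
  then show ?thesis
    using True by (intro that[of "DIM('a)" "\<lambda>i. u (g i)"]) (auto simp: sum.reindex)
next
  case False
  then obtain i j where ij: "i \<noteq> j" "g i = g j" "i \<le> DIM('a)" "j \<le> DIM('a)"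
    by (auto simp: inj_on_def)
  have "(\<Sum>k\<le>DIM('a). ((if k = i then 1 else 0) - (if k = j then 1 else 0 :: real)) *\<^sub>R g k) = 0"
    using ij by (simp add: scaleR_left_diff_distrib sum_subtractf
        if_distrib[of "\<lambda>x. x *\<^sub>R _"] cong: if_cong)
  with ij show ?thesis
    by (intro that[of "DIM('a)" "\<lambda>k. (if k = i then 1 else 0) - (if k = j then 1 else 0)"]) auto
qed

text \<open>Complex matrices form a finite-dimensional real space, so the powers of \<open>F\<close>
  satisfy a nontrivial real relation. This yields a nonzero annihilating polynomial without the
  Cayley-Hamilton theorem; its leading scalar cancels after factorization.\<close>

lemma matrix_annihilated_by_factors:
  fixes F :: "complex^'n::finite^'n"
  obtains as where "mfactors F as (mat 1) = 0"
proof -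
  obtain c n where c: "\<exists>i\<le>n. c i \<noteq> 0" "(\<Sum>i\<le>n. c i *\<^sub>R mpow F i) = 0"
    using sequence_linearly_dependent[of "mpow F"] by metis
  define p where "p = (\<Sum>i\<le>n. monom (complex_of_real (c i)) i)"
  have "coeff p i = of_real (c i)" if "i \<le> n" for i
    using that by (simp add: p_def coeff_sum if_distrib cong: if_cong)
  with c(1) have "p \<noteq> 0" by force
  have "mat (complex_of_real r) ** M = r *\<^sub>R M" for r and M :: "complex^'n^'n"
    by (simp add: vec_eq_iff mat_mult_component) (simp add: scaleR_conv_of_real)
  then have "mpoly F p = 0"
    using c(2) by (simp add: p_def mpoly_sum mpoly_monom)
  moreover obtain d as where d: "d \<noteq> 0" "mpoly F p = mat d ** mfactors F as (mat 1)"
    using mpoly_eq_mfactors[OF \<open>p \<noteq> 0\<close>] by metis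
  ultimately have "mfactors F as (mat 1) = 0"
    by (simp add: vec_eq_iff) (metis mat_mult_component mult_eq_0_iff zero_index)
  then show ?thesis using that by blast
qed

subsection \<open>The generalized Sylvester equation over the complex numbers\<close>

text \<open>With a linear right inverse \<open>S\<close> of \<open>T\<close>, the map
  \<open>H (x, z) = S x + G z\<close> is injective between spaces of equal dimension, hence onto.
  Applying \<open>T\<close> to \<open>p = H (x, z)\<close> gives \<open>x = 0\<close>, so only the
  \<open>G\<close> part remains.\<close>

lemma in_range_if_exact_dim:
  fixes T :: "'e::euclidean_space \<Rightarrow> 'g::euclidean_space" and G :: "'z::euclidean_space \<Rightarrow> 'e"
  assumes "linear T" "surj T" "linear G" "inj G" "\<And>z. T (G z) = 0"
    and "DIM('e) = DIM('g) + DIM('z)" and "T p = 0"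
  shows "p \<in> range G"
proof -
  obtain S where S: "linear S" "\<And>x. T (S x) = x"
    using linear_surjective_right_inverse[OF assms(1,2)] by (metis comp_apply id_apply)
  define H where "H = (\<lambda>(x, z). S x + G z)"
  have "linear H"
    by (rule linearI) (auto simp: H_def linear_add linear_cmul S assms scaleR_add_right)
  have TH: "T (H (x, z)) = x" for x z
    using assms by (simp add: H_def linear_add S)
  have "inj H"
  proof (rule injI)
    fix u v assume eq: "H u = H v"
    then have "fst u = fst v" by (metis TH surjective_pairing)
    moreover from this eq have "G (snd u) = G (snd v)"
      by (simp add: H_def case_prod_unfold)
    ultimately show "u = v" using \<open>inj G\<close> by (simp add: injD prod_eq_iff)
  qed
  then have "dim (range H) = DIM('g \<times> 'z)"
    by (subst dim_image_eq[OF \<open>linear H\<close>]) (simp_all only: span_UNIV dim_UNIV)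
  then have "span (range H) = UNIV"
    using assms(6) by (simp only: dim_eq_full[symmetric] DIM_prod)
  moreover have "subspace (range H)"
    using \<open>linear H\<close> by (simp add: linear_subspace_image)
  ultimately have "p \<in> range H" by (metis UNIV_I span_eq_iff)
  then obtain x z where "p = H (x, z)" by (metis rangeE surj_pair)
  moreover from this have "x = 0" using TH assms(7) by simp
  ultimately show ?thesis
    using S by (simp add: H_def linear_0)
qed

text \<open>For nonzero \<open>Z\<close>, the last nonzero partial product would lie in
  \<open>K\<close> and be killed by the next factor, that is, its rows would satisfy a left
  eigenvector equation of \<open>F\<close>.\<close>

lemma mfactors_eq_0_imp_eq_0:
  fixes F :: "'a::comm_ring_1^'q::finite^'q" and K :: "('a^'q^'m::finite) set"
  assumes K: "\<And>Z a. Z \<in> K \<Longrightarrow> Z ** (F - mat a) \<in> K"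
    and no_eigen: "\<And>Z a. Z \<in> K \<Longrightarrow> Z ** (F - mat a) = 0 \<Longrightarrow> Z = 0"
    and "Z \<in> K" "mfactors F as Z = 0"
  shows "Z = 0"
  using assms(3,4)
proof (induction as arbitrary: Z)
  case (Cons a as)
  then show ?case using K no_eigen by (metis mfactors_Cons)
qed simp

section \<open>The map \<open>T\<close> and its surjectivity\<close>

definition msylv ::
  "'a::comm_ring_1^'n::finite^'n \<Rightarrow> 'a^'m::finite^'n \<Rightarrow> 'a^'q::finite^'q \<Rightarrow>
    ('a^'q^'n) \<times> ('a^'q^'m) \<Rightarrow> 'a^'q^'n" where
  "msylv A B F = (\<lambda>(X, Y). A ** X + B ** Y - X ** F)"

text \<open>Used with \<open>G = F - mat a\<close>: it makes the range of \<open>T\<close> stable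
  under right multiplication by such factors.\<close>

lemma msylv_mult_right:
  assumes "G ** F = F ** G"
  shows "msylv A B F (X ** G, Y ** G) = msylv A B F (X, Y) ** G"
  by (simp add: msylv_def matrix_distribs flip: matrix_mul_assoc) (simp only: assms)

lemma linear_msylv: "linear (msylv A B F)" for A :: "complex^'n::finite^'n"
  by (rule linearI)
    (auto simp: msylv_def matrix_distribs matrix_scaleR_left matrix_scaleR_right algebra_simps)

lemma hcat_mult_matrix:
  "hcat A B ** M = A ** (\<chi> i. M $ Inl i) + B ** (\<chi> i. M $ Inr i)"
  for A :: "'a::comm_ring_1^'n::finite^'k::finite" and B :: "'a^'m::finite^'k"
  by (simp add: vec_eq_iff matrix_matrix_mult_def hcat_def UNIV_Plus_UNIV[symmetric]
      sum.Plus del: UNIV_Plus_UNIV)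

lemma surj_msylv:
  fixes A :: "complex^'n::finite^'n" and B :: "complex^'m::finite^'n"
    and F :: "complex^'q::finite^'q"
  assumes ctrl: "\<And>s. rank (hcat (mat s - A) B) = CARD('n)"
  shows "surj (msylv A B F)"
proof -
  let ?T = "msylv A B F"
  \<comment> \<open>Controllability at \<open>a\<close> solves \<open>R = (a - A) U + B V\<close>.
    Taking \<open>- U\<close> as first argument of \<open>T\<close> makes the terms
    \<open>U F\<close> cancel, and the remainder is \<open>(- U) (F - a)\<close>.\<close>
  have step: "\<exists>U P. R = ?T P + U ** (F - mat a)" for R :: "complex^'q^'n" and a
  proof -
    obtain C where C: "hcat (mat a - A) B ** C = mat 1"
      using right_invertible_if_full_row_rank[OF ctrl] by blast
    define U V where "U = (\<chi> i. C $ Inl i) ** R" and "V = (\<chi> i. C $ Inr i) ** R"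
    have "R = (hcat (mat a - A) B ** C) ** R" using C by simp
    also have "\<dots> = (mat a - A) ** U + B ** V"
      by (simp add: hcat_mult_matrix matrix_distribs matrix_mul_assoc U_def V_def)
    also have "\<dots> = ?T (- U, V) + (- U) ** (F - mat a)"
      by (simp add: msylv_def matrix_distribs mat_mult_commute)
    finally show ?thesis by blast
  qed
  \<comment> \<open>The remainder is itself decomposed and reinserted: since \<open>F - a\<close>
    commutes with \<open>F\<close>, its \<open>T\<close> part stays in the range of
    \<open>T\<close>, and the new remainder carries one more factor.\<close>
  have "\<exists>U P. R = ?T P + mfactors F as U" for R as
  proof (induction as arbitrary: R rule: rev_induct)
    case Nil
    have "R = ?T 0 + mfactors F [] R"
      using linear_0[OF linear_msylv] by simp
    then show ?case by blast
  next
    case (snoc a as)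
    obtain U P where U: "R = ?T P + U ** (F - mat a)" using step by blast
    obtain U' X Y where U': "U = ?T (X, Y) + mfactors F as U'" using snoc by fast
    have "(F - mat a) ** F = F ** (F - mat a)"
      by (simp add: matrix_distribs mat_mult_commute)
    then have "U ** (F - mat a) =
        ?T (X ** (F - mat a), Y ** (F - mat a)) + mfactors F (as @ [a]) U'"
      by (simp only: U' msylv_mult_right mfactors_snoc matrix_mult_add_left)
    then have "R = ?T (P + (X ** (F - mat a), Y ** (F - mat a))) + mfactors F (as @ [a]) U'"
      unfolding U linear_add[OF linear_msylv] by (simp only: add.assoc)
    then show ?case by blast
  qed
  moreover obtain as where "mfactors F as (mat 1) = 0"
    using matrix_annihilated_by_factors by blast
  then have "mfactors F as U = 0" for U :: "complex^'q^'n"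
    by (subst mfactors_eq_mult) simp
  ultimately have "\<exists>P. R = ?T P" for R
    by (metis add.right_neutral)
  then show ?thesis unfolding surj_def by blast
qed

section \<open>The components of the map \<open>G\<close> and its injectivity\<close>

definition mcomb :: "(nat \<Rightarrow> 'a::comm_ring_1^'m::finite^'n::finite) \<Rightarrow> nat \<Rightarrow> 'a^'q::finite^'q \<Rightarrow>
    'a^'q^'m \<Rightarrow> 'a^'q^'n" where
  "mcomb N w F Z = (\<Sum>i\<le>w. N i ** Z ** mpow F i)"

lemma mcomb_mult_right:
  assumes "G ** F = F ** G"
  shows "mcomb N w F (Z ** G) = mcomb N w F Z ** G"
  by (simp add: mcomb_def matrix_mult_sum_left mpow_commute[OF assms] flip: matrix_mul_assoc)

lemma linear_mcomb: "linear (mcomb N w F)" for N :: "nat \<Rightarrow> complex^'m::finite^'n::finite"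
  by (rule linearI)
    (simp_all add: mcomb_def matrix_distribs matrix_scaleR_left matrix_scaleR_right
      sum.distrib scaleR_sum_right)

lemma peval_sum_pmonom:
  "peval (\<Sum>i\<le>w. pmonom (N i) i) s = (\<Sum>i\<le>w. mat (s ^ i) ** N i)"
  for N :: "nat \<Rightarrow> 'a::comm_ring_1^'m::finite^'n::finite"
  by (simp add: vec_eq_iff peval_def poly_sum pmonom_def poly_monom mat_mult_component mult.commute)

text \<open>If \<open>F\<close> acts on \<open>Z\<close> from the right as the scalar
  \<open>s\<close>, so do its powers with \<open>s ^ i\<close>, and the sum collapses to the
  polynomial matrix evaluated at \<open>s\<close>. This is the link between \<open>G\<close> and
  right-coprimeness.\<close>

lemma mcomb_eigen:
  assumes "Z ** F = mat s ** Z"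
  shows "mcomb N w F Z = peval (\<Sum>i\<le>w. pmonom (N i) i) s ** Z"
proof -
  have "Z ** mpow F i = mat (s ^ i) ** Z" for i
  proof (induction i)
    case (Suc i)
    have "Z ** mpow F (Suc i) = mat (s ^ i) ** (Z ** F)"
      by (simp add: matrix_mul_assoc Suc)
    then show ?case
      by (simp add: assms matrix_mul_assoc mat_mult_mat mult.commute)
  qed simp
  then show ?thesis
    by (simp add: mcomb_def peval_sum_pmonom matrix_mult_sum_left mat_mult_left_commute
        flip: matrix_mul_assoc)
qed

lemma mcomb_pair_inj:
  fixes N :: "nat \<Rightarrow> complex^'m::finite^'n::finite" and D :: "nat \<Rightarrow> complex^'m^'k::finite"
    and F :: "complex^'q::finite^'q"
  assumes cop: "\<And>s v. peval (\<Sum>i\<le>w. pmonom (N i) i) s *v v = 0 \<Longrightarrow>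
      peval (\<Sum>i\<le>w. pmonom (D i) i) s *v v = 0 \<Longrightarrow> v = 0"
    and "mcomb N w F Z = 0" "mcomb D w F Z = 0"
  shows "Z = 0"
proof -
  let ?K = "{Z. mcomb N w F Z = 0 \<and> mcomb D w F Z = 0}"
  obtain as where as: "mfactors F as (mat 1) = 0"
    using matrix_annihilated_by_factors by blast
  show ?thesis
  proof (rule mfactors_eq_0_imp_eq_0[of ?K F Z as])
    fix Z :: "complex^'q^'m" and a assume Z: "Z \<in> ?K"
    have "(F - mat a) ** F = F ** (F - mat a)"
      by (simp add: matrix_distribs mat_mult_commute)
    with Z show "Z ** (F - mat a) \<in> ?K"
      by (simp add: mcomb_mult_right)
    assume "Z ** (F - mat a) = 0"
    then have "Z ** F = mat a ** Z"
      by (simp add: matrix_distribs mat_mult_commute)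
    then show "Z = 0"
      using Z cop[of a] by (intro matrix_mult_eq_0_if_injective[of _ _ Z]) (auto simp: mcomb_eigen)
  next
    show "mfactors F as Z = 0"
      using as by (metis mfactors_eq_mult times0_right)
  qed (use assms in auto)
qed

section \<open>Comparison of coefficients: the range of \<open>G\<close> lies in the kernel of
  \<open>T\<close>\<close>

definition pcoeff :: "'a::zero poly^'m^'n \<Rightarrow> nat \<Rightarrow> 'a^'m^'n" where
  "pcoeff P k = (\<chi> i j. coeff (P $ i $ j) k)"

lemma pcoeff_sum_pmonom:
  "pcoeff (\<Sum>i\<le>w. pmonom (N i) i) k = (if k \<le> w then N k else 0)"
  by (simp add: vec_eq_iff pcoeff_def coeff_sum pmonom_def)

lemma pcoeff_pconst_mult: "pcoeff (pconst A ** P) k = A ** pcoeff P k"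
  by (simp add: vec_eq_iff pcoeff_def pconst_def matrix_matrix_mult_def coeff_sum)

lemma pcoeff_shift: "pcoeff (mat [:0, 1:] ** P) k = (case k of 0 \<Rightarrow> 0 | Suc j \<Rightarrow> pcoeff P j)"
  for P :: "'a::comm_ring_1 poly^'m::finite^'n::finite"
  by (simp add: vec_eq_iff pcoeff_def mat_mult_component split: nat.split)

text \<open>Comparing coefficients in the polynomial identity gives
  \<open>A N_k + B D_k = N_(k-1)\<close>, so \<open>A X + B Y\<close> is the sum for
  \<open>X\<close> shifted by one power of \<open>F\<close>, which is \<open>X F\<close>.\<close>

lemma msylv_mcomb:
  fixes N :: "nat \<Rightarrow> 'a::comm_ring_1^'m::finite^'n::finite" and D :: "nat \<Rightarrow> 'a^'m^'m"
  assumes "(mat [:0, 1:] - pconst A) ** (\<Sum>i\<le>w. pmonom (N i) i) =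
      pconst B ** (\<Sum>i\<le>w. pmonom (D i) i)"
  shows "msylv A B F (mcomb N w F Z, mcomb D w F Z) = 0"
proof -
  \<comment> \<open>Zero padding makes the recurrence valid for every \<open>k\<close>, including
    \<open>Suc w\<close>.\<close>
  let ?N = "\<lambda>k. if k \<le> w then N k else 0" and ?D = "\<lambda>k. if k \<le> w then D k else 0"
  have "pcoeff ((mat [:0, 1:] - pconst A) ** (\<Sum>i\<le>w. pmonom (N i) i)) k =
      pcoeff (pconst B ** (\<Sum>i\<le>w. pmonom (D i) i)) k" for k
    using assms by simp
  moreover have "pcoeff (P - Q) k = pcoeff P k - pcoeff Q k" for P Q :: "'a poly^'m^'n" and k
    by (simp add: vec_eq_iff pcoeff_def)
  ultimately have coeff: "A ** ?N k + B ** ?D k = (case k of 0 \<Rightarrow> 0 | Suc j \<Rightarrow> ?N j)" for k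
    by (simp only: matrix_mult_diff_left pcoeff_shift pcoeff_pconst_mult pcoeff_sum_pmonom
        diff_eq_eq) (simp only: add.commute)
  have "A ** mcomb N w F Z + B ** mcomb D w F Z =
      (\<Sum>i\<le>w. (A ** ?N i + B ** ?D i) ** Z ** mpow F i)"
    by (simp add: mcomb_def matrix_mult_sum_right matrix_distribs matrix_mul_assoc sum.distrib)
  \<comment> \<open>The coefficient of degree \<open>Suc w\<close> vanishes and yields \<open>N w = 0\<close>, so the shift loses no term.\<close>
  also have "\<dots> = (\<Sum>i\<le>Suc w. (A ** ?N i + B ** ?D i) ** Z ** mpow F i)"
    by simp
  also have "\<dots> = (\<Sum>i\<le>w. ?N i ** Z ** mpow F (Suc i))"
    unfolding coeff by (subst sum.atMost_Suc_shift) simp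
  also have "\<dots> = mcomb N w F Z ** F"
    by (simp add: mcomb_def matrix_mult_sum_left matrix_mul_assoc)
  finally show ?thesis by (simp add: msylv_def)
qed

text \<open>Uniqueness of \<open>Z\<close>, which is the injectivity of \<open>G\<close>, is part of
  the conclusion because the descent to bimatrices relies on it.\<close>

theorem complex_sylvester_solutions:
  fixes A :: "complex^'n::finite^'n" and B :: "complex^'m::finite^'n"
    and F :: "complex^'q::finite^'q" and N :: "nat \<Rightarrow> complex^'m^'n" and D :: "nat \<Rightarrow> complex^'m^'m"
  assumes ctrl: "\<And>s. rank (hcat (mat s - A) B) = CARD('n)"
    and eq: "(mat [:0, 1:] - pconst A) ** (\<Sum>i\<le>w. pmonom (N i) i) =
      pconst B ** (\<Sum>i\<le>w. pmonom (D i) i)"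
    and cop: "\<And>s v. peval (\<Sum>i\<le>w. pmonom (N i) i) s *v v = 0 \<Longrightarrow>
      peval (\<Sum>i\<le>w. pmonom (D i) i) s *v v = 0 \<Longrightarrow> v = 0"
  shows "A ** X + B ** Y = X ** F \<longleftrightarrow> (\<exists>!Z. X = mcomb N w F Z \<and> Y = mcomb D w F Z)"
proof -
  let ?G = "\<lambda>Z. (mcomb N w F Z, mcomb D w F Z)"
  have lin: "linear ?G"
    by (rule linearI) (simp_all add: linear_add[OF linear_mcomb] linear_cmul[OF linear_mcomb])
  have inj: "inj ?G"
    unfolding linear_injective_0[OF lin]
  proof (intro allI impI)
    fix Z :: "complex^'q^'m"
    assume "?G Z = 0"
    then have "mcomb N w F Z = 0" "mcomb D w F Z = 0"
      by (simp_all add: zero_prod_def)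
    then show "Z = 0"
      by (rule mcomb_pair_inj[of N w D F Z, rotated]) (fact cop)
  qed
  have "A ** X + B ** Y = X ** F \<longleftrightarrow> msylv A B F (X, Y) = 0"
    by (simp add: msylv_def)
  also have "\<dots> \<longleftrightarrow> (X, Y) \<in> range ?G"
  proof
    \<comment> \<open>The dimensions match because \<open>Y\<close> and \<open>Z\<close> have the
      same size, each \<open>D i\<close> being square.\<close>
    have "DIM((complex^'q^'n) \<times> (complex^'q^'m)) = DIM(complex^'q^'n) + DIM(complex^'q^'m)"
      by simp
    then show "msylv A B F (X, Y) = 0 \<Longrightarrow> (X, Y) \<in> range ?G"
      by (rule in_range_if_exact_dim[OF linear_msylv surj_msylv[OF ctrl] lin inj msylv_mcomb[OF eq]])
  next
    assume "(X, Y) \<in> range ?G"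
    then obtain Z where "(X, Y) = ?G Z" by (rule rangeE)
    then show "msylv A B F (X, Y) = 0" by (simp only: msylv_mcomb[OF eq])
  qed
  also have "\<dots> \<longleftrightarrow> (\<exists>!Z. X = mcomb N w F Z \<and> Y = mcomb D w F Z)"
  proof
    assume "(X, Y) \<in> range ?G"
    then obtain Z where Z: "(X, Y) = ?G Z" by (rule rangeE)
    show "\<exists>!Z. X = mcomb N w F Z \<and> Y = mcomb D w F Z"
    proof (rule ex1I)
      show "X = mcomb N w F Z \<and> Y = mcomb D w F Z" using Z by simp
      fix Z' assume "X = mcomb N w F Z' \<and> Y = mcomb D w F Z'"
      with Z have "?G Z' = ?G Z" by simp
      then show "Z' = Z" by (rule injD[OF inj])
    qed
  qed auto
  finally show ?thesis .
qed

subsection \<open>Liftings of bimatrices\<close>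

lemma cconj_one: "cconj 1 = 1"
  using cconj_mult[of "cconj 1" 1] by (simp add: cconj_cconj)

lemma cconj_minus: "cconj (- x) = - cconj x"
  using cconj_add[of x "- x"] by (simp add: cconj_zero eq_neg_iff_add_eq_0 add.commute)

lemma cconj_diff: "cconj (x - y) = cconj x - cconj y"
  by (simp add: diff_conv_add_uminus cconj_add cconj_minus del: add_uminus_conv_diff)

lemma cconj_monom: "cconj (monom a k) = monom (cconj a) k"
  by (simp add: cconj_poly_def map_poly_monom cconj_zero)

lemma cconj_const_poly: "cconj [:a:] = [:cconj a:]"
  using cconj_monom[of a 0] by (simp add: monom_0)

lemma lifting_component [simp]:
  "lifting (P1, P2) $ Inl i $ Inl j = P1 $ i $ j"
  "lifting (P1, P2) $ Inl i $ Inr j = cconj (P2 $ i $ j)"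
  "lifting (P1, P2) $ Inr i $ Inl j = P2 $ i $ j"
  "lifting (P1, P2) $ Inr i $ Inr j = cconj (P1 $ i $ j)"
  by (simp_all add: vcat_def hcat_def mconj_def)

declare lifting.simps [simp del]

lemma vec_eq_sum_index_iff:
  "A = B \<longleftrightarrow> (\<forall>i. A $ Inl i = B $ Inl i) \<and> (\<forall>i. A $ Inr i = B $ Inr i)"
  by (simp add: vec_eq_iff split_sum_all)

lemma sum_UNIV_Plus:
  "(\<Sum>k\<in>(UNIV :: ('a::finite + 'b::finite) set). f k) =
    (\<Sum>i\<in>UNIV. f (Inl i)) + (\<Sum>i\<in>UNIV. f (Inr i))"
  by (simp add: sum.Plus flip: UNIV_Plus_UNIV)

lemma lifting_eq_iff: "lifting P = lifting Q \<longleftrightarrow> P = Q"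
  by (cases P; cases Q) (auto simp: vec_eq_sum_index_iff vec_eq_iff)

text \<open>The lifting sends the stacked vector of \<open>x\<close> and its conjugate to that of
  the image of \<open>x\<close> and its conjugate, so composition becomes the matrix
  product.\<close>

lemma lifting_mult: "lifting (P \<odot> Q) = lifting P ** lifting Q"
  by (cases P; cases Q)
    (simp add: vec_eq_sum_index_iff matrix_matrix_mult_def sum_UNIV_Plus mconj_def cconj_add
      cconj_mult cconj_cconj cconj_sum algebra_simps)

lemma lifting_add: "lifting (P + Q) = lifting P + lifting Q"
  by (cases P; cases Q) (simp add: vec_eq_sum_index_iff cconj_add)

lemma lifting_0: "lifting 0 = 0"
  by (simp add: zero_prod_def vec_eq_sum_index_iff cconj_zero)

lemma lifting_sum: "lifting (sum f S) = (\<Sum>i\<in>S. lifting (f i))"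
  by (induction S rule: infinite_finite_induct) (simp_all add: lifting_add lifting_0)

lemma lifting_bpow: "lifting (bpow F k) = mpow (lifting F) k"
proof (induction k)
  case 0
  show ?case
    by (simp add: vec_eq_sum_index_iff mat_def cconj_one cconj_zero)
qed (simp add: lifting_mult)

text \<open>The indeterminate is its own conjugate, so it appears unchanged in both diagonal
  blocks.\<close>

lemma lifting_char_matrix:
  "lifting (mat [:0, 1:] - pconst A1, - pconst A2) = mat [:0, 1:] - pconst (lifting (A1, A2))"
proof -
  have "cconj [:0, 1:] = [:0, 1 :: 'a:]"
    using cconj_monom[of "1 :: 'a" 1] by (simp add: cconj_one monom_altdef)
  then show ?thesis
    by (simp add: vec_eq_sum_index_iff mat_def pconst_def cconj_diff cconj_minus
        cconj_const_poly cconj_cconj cconj_zero)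
qed

lemma lifting_pconst: "lifting (pconst A1, pconst A2) = pconst (lifting (A1, A2))"
  by (simp add: vec_eq_sum_index_iff pconst_def cconj_const_poly)

lemma lifting_sum_pmonom:
  "lifting (\<Sum>i\<le>w. pmonom (N1 i) i, \<Sum>i\<le>w. pmonom (N2 i) i) =
    (\<Sum>i\<le>w. pmonom (lifting (N1 i, N2 i)) i)"
  by (simp add: vec_eq_sum_index_iff pmonom_def cconj_monom cconj_sum)

lemma lifting_mcomb:
  "lifting (\<Sum>i\<le>w. N i \<odot> Z \<odot> bpow F i) = mcomb (\<lambda>i. lifting (N i)) w (lifting F) (lifting Z)"
  by (simp add: lifting_sum lifting_mult lifting_bpow mcomb_def)

text \<open>The lifting of the stacked bimatrix has the rows of the two separate liftings in another
  order, so its kernel is their common kernel.\<close>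

lemma right_coprime_injective:
  fixes N :: "(complex poly, 'n::finite, 'm::finite) bimatrix"
    and D :: "(complex poly, 'k::finite, 'm) bimatrix"
  assumes "right_coprime N D"
    and "peval (lifting N) s *v v = 0" "peval (lifting D) s *v v = 0"
  shows "v = 0"
proof (rule injective_if_full_column_rank)
  show "rank (peval (lifting (bvcat N D)) s) = CARD('m + 'm)"
    using assms(1) by (simp add: right_coprime_def mult_2)
  show "peval (lifting (bvcat N D)) s *v v = 0"
    using assms(2,3)
    by (cases N; cases D)
      (simp add: vec_eq_sum_index_iff vec_eq_iff split_sum_all matrix_vector_mult_def
        sum_UNIV_Plus peval_def vcat_def)
qed

section \<open>The conjugation symmetry whose fixed points are the liftings\<close>

primrec swap_sum :: "'a + 'a \<Rightarrow> 'a + 'a" where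
  "swap_sum (Inl i) = Inr i"
| "swap_sum (Inr i) = Inl i"

text \<open>This is \<open>J W' J\<close>, where \<open>W'\<close> is the entrywise conjugate of
  \<open>W\<close> and \<open>J\<close> exchanges the two blocks.\<close>

definition block_conj :: "'a::conj_ring^('m::finite + 'm)^('n::finite + 'n) \<Rightarrow> 'a^('m + 'm)^('n + 'n)" where
  "block_conj W = (\<chi> i j. cconj (W $ swap_sum i $ swap_sum j))"

lemma block_conj_lifting [simp]: "block_conj (lifting P) = lifting P"
  by (cases P) (simp add: vec_eq_sum_index_iff block_conj_def cconj_cconj)

lemma block_conj_fixed_imp_lifting:
  fixes W :: "'a::conj_ring^('m::finite + 'm)^('n::finite + 'n)"
  assumes "block_conj W = W"
  shows "\<exists>P. W = lifting P"
proof -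
  have W: "W $ i $ j = cconj (W $ swap_sum i $ swap_sum j)" for i j
    using arg_cong[OF assms, of "\<lambda>V. V $ i $ j"] by (simp add: block_conj_def)
  show ?thesis
    \<comment> \<open>The first block column supplies the bimatrix; the symmetry determines the
      second block column from it.\<close>
    by (rule exI[of _ "(\<chi> i j. W $ Inl i $ Inl j, \<chi> i j. W $ Inr i $ Inl j)"])
      (simp add: vec_eq_sum_index_iff W[of "Inl _" "Inr _"] W[of "Inr _" "Inr _"])
qed

lemma block_conj_mult: "block_conj (V ** W) = block_conj V ** block_conj W"
  for V :: "'a::conj_ring^('m::finite + 'm)^('n::finite + 'n)"
    and W :: "'a^('q::finite + 'q)^('m + 'm)"
  by (simp add: vec_eq_iff block_conj_def matrix_matrix_mult_def sum_UNIV_Plus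
      cconj_add cconj_sum cconj_mult add.commute)

lemma block_conj_sum: "block_conj (sum f S) = (\<Sum>i\<in>S. block_conj (f i))"
  for f :: "'i \<Rightarrow> 'a::conj_ring^('m::finite + 'm)^('n::finite + 'n)"
  by (simp add: vec_eq_iff block_conj_def cconj_sum)

text \<open>The coefficients and the powers of \<open>lifting F\<close> are fixed by the symmetry,
  so it acts on \<open>Z\<close> alone.\<close>

lemma block_conj_mcomb:
  "block_conj (mcomb (\<lambda>i. lifting (N i)) w (lifting F) Z) =
    mcomb (\<lambda>i. lifting (N i)) w (lifting F) (block_conj Z)"
  by (simp add: mcomb_def block_conj_sum block_conj_mult flip: lifting_bpow)

section \<open>Descent from the complex equation to bimatrices\<close>

theorem theorem1:
  fixes A1 A2 :: "complex^'n^'n" and B1 B2 :: "complex^'m^'n" and F1 F2 :: "complex^'p^'p"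
    and N1 N2 :: "complex poly^'m^'n" and D1 D2 :: "complex poly^'m^'m"
    and N1c N2c :: "nat \<Rightarrow> complex^'m^'n" and D1c D2c :: "nat \<Rightarrow> complex^'m^'m"
    and \<omega> :: nat
    and X :: "(complex, 'n, 'p) bimatrix" and Y :: "(complex, 'm, 'p) bimatrix"
  assumes "controllable (A1, A2) (B1, B2)"
    and "(mat [:0, 1:] - pconst A1, - pconst A2) \<odot> (N1, N2) =
         (pconst B1, pconst B2) \<odot> (D1, D2)"
    and "right_coprime (N1, N2) (D1, D2)"
    and "N1 = (\<Sum>i\<le>\<omega>. pmonom (N1c i) i)" and "N2 = (\<Sum>i\<le>\<omega>. pmonom (N2c i) i)"
    and "D1 = (\<Sum>i\<le>\<omega>. pmonom (D1c i) i)" and "D2 = (\<Sum>i\<le>\<omega>. pmonom (D2c i) i)"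
  shows "(A1, A2) \<odot> X + (B1, B2) \<odot> Y = X \<odot> (F1, F2) \<longleftrightarrow>
         (\<exists>Z :: (complex, 'm, 'p) bimatrix.
            X = (\<Sum>i\<le>\<omega>. (N1c i, N2c i) \<odot> Z \<odot> bpow (F1, F2) i) \<and>
            Y = (\<Sum>i\<le>\<omega>. (D1c i, D2c i) \<odot> Z \<odot> bpow (F1, F2) i))"
proof -
  let ?A = "lifting (A1, A2)" and ?B = "lifting (B1, B2)" and ?F = "lifting (F1, F2)"
  let ?N = "\<lambda>i. lifting (N1c i, N2c i)" and ?D = "\<lambda>i. lifting (D1c i, D2c i)"
  have N: "lifting (N1, N2) = (\<Sum>i\<le>\<omega>. pmonom (?N i) i)"
    and D: "lifting (D1, D2) = (\<Sum>i\<le>\<omega>. pmonom (?D i) i)"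
    unfolding assms(4-7) by (rule lifting_sum_pmonom)+
  have ctrl: "rank (hcat (mat s - ?A) ?B) = CARD('n + 'n)" for s
    using assms(1) by (simp add: controllable_def mult_2)
  have eq: "(mat [:0, 1:] - pconst ?A) ** (\<Sum>i\<le>\<omega>. pmonom (?N i) i) =
      pconst ?B ** (\<Sum>i\<le>\<omega>. pmonom (?D i) i)"
    using arg_cong[OF assms(2), of lifting]
    by (simp only: lifting_mult lifting_char_matrix lifting_pconst N D)
  have cop: "v = 0" if "peval (\<Sum>i\<le>\<omega>. pmonom (?N i) i) s *v v = 0"
      "peval (\<Sum>i\<le>\<omega>. pmonom (?D i) i) s *v v = 0" for s v
    using right_coprime_injective[OF assms(3)] that by (simp only: N D)
  have "(A1, A2) \<odot> X + (B1, B2) \<odot> Y = X \<odot> (F1, F2) \<longleftrightarrow>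
      ?A ** lifting X + ?B ** lifting Y = lifting X ** ?F"
    by (simp only: lifting_mult lifting_add flip: lifting_eq_iff)
  also have "\<dots> \<longleftrightarrow>
      (\<exists>!W. lifting X = mcomb ?N \<omega> ?F W \<and> lifting Y = mcomb ?D \<omega> ?F W)"
    by (rule complex_sylvester_solutions[OF ctrl eq]) (fact cop)
  also have "\<dots> \<longleftrightarrow> (\<exists>Z. lifting X = mcomb ?N \<omega> ?F (lifting Z) \<and> lifting Y = mcomb ?D \<omega> ?F (lifting Z))"
    (is "?unique \<longleftrightarrow> ?lifted")
  proof
    assume ?unique
    then obtain W where W: "lifting X = mcomb ?N \<omega> ?F W" "lifting Y = mcomb ?D \<omega> ?F W"
      and uniq: "\<And>V. lifting X = mcomb ?N \<omega> ?F V \<Longrightarrow> lifting Y = mcomb ?D \<omega> ?F V \<Longrightarrow> V = W"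
      by (elim ex1E) blast
    \<comment> \<open>Both \<open>lifting X\<close> and \<open>lifting Y\<close> are fixed by the
      symmetry, so \<open>block_conj W\<close> is another parameter for the same solution and must
      equal \<open>W\<close>.\<close>
    have "block_conj W = W"
    proof (rule uniq)
      show "lifting X = mcomb ?N \<omega> ?F (block_conj W)" "lifting Y = mcomb ?D \<omega> ?F (block_conj W)"
        by (simp_all only: W(1)[symmetric] W(2)[symmetric] block_conj_lifting
            flip: block_conj_mcomb)
    qed
    then have "\<exists>Z. W = lifting Z" by (rule block_conj_fixed_imp_lifting)
    then obtain Z where "W = lifting Z" by (elim exE)
    with W show ?lifted by (intro exI[of _ Z]) simp
  next
    assume ?lifted
    then obtain Z where Z: "lifting X = mcomb ?N \<omega> ?F (lifting Z)"
      "lifting Y = mcomb ?D \<omega> ?F (lifting Z)" by blast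
    \<comment> \<open>Uniqueness among all complex \<open>W\<close>, not only liftings, is recovered
      by returning to the equation.\<close>
    then have "?A ** lifting X + ?B ** lifting Y = lifting X ** ?F"
      using msylv_mcomb[OF eq, of ?F "lifting Z"] by (simp add: msylv_def)
    then show ?unique
      by (subst (asm) complex_sylvester_solutions[OF ctrl eq]) (fact cop)
  qed
  finally show ?thesis
    by (simp only: lifting_mcomb flip: lifting_eq_iff)
qed

end
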